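(* Let $0<q<1$ and let $u$ be an arbitrary nonzero complex number. (1) Let $t$ be a positive rational number and let $\lambda\in\mathbb{S}(t)$. There are infinitely many pairs of positive integers $n$ and $m$ such that $$tn=m+\lambda .$$ For each such $\lambda$, $n$ and $m$ we have $$A_{q}(q^{-nt}u)=\frac{(-u)^{\lfloor m/2\rfloor}\left\{\theta(-u^{-1}q^{\chi(m)+\lambda};q^{2})+r(n)\right\}}{(q;q)_{\infty}\,q^{\lfloor m/2\rfloor(nt-\lfloor m/2\rfloor)}},$$ where, for all such $n$ sufficiently large (with $q,u,t,\lambda$ fixed), $$|r(n)|\le\frac{3(-q^{3};q)_{\infty}\,\theta(|u|^{-1};q)}{1-q}\left\{q^{m/4}+\frac{q^{m^{2}/16}}{|u|^{\lfloor m/4\rfloor+1}}\right\}.$$ (2) Let $t$ be a positive irrational number and let $\beta\in[0,1)$. There are infinitely many pairs of positive integers $n$ and $m$ such that $$nt=m+\beta+\gamma_{n}\quad\text{with}\quad|\gamma_{n}|\le\frac{3}{n}.$$ Let $$\nu_{n}=\left\lfloor-\frac{q^{2}\log n}{\log q}\right\rfloor .$$ For each such $\beta$, $n$ and $m$ we have $$A_{q}(q^{-nt}u)=\frac{(-u)^{\lfloor m/2\rfloor}\left\{\theta(-u^{-1}q^{\chi(m)+\beta};q^{2})+e(n)\right\}}{(q;q)_{\infty}\,q^{\lfloor m/2\rfloor(nt-\lfloor m/2\rfloor)}},$$ where, for all such $n$ sufficiently large (with $q,u,t,\beta$ fixed), $$|e(n)|\le\frac{48(-q^{3};q)_{\infty}\,\theta(|u|^{-1};q)}{1-q}\left\{\frac{\log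 n}{n}+q^{\nu_{n}^{2}/2}|u|^{\nu_{n}}+\frac{q^{\nu_{n}^{2}/2}}{|u|^{1+\nu_{n}}}\right\}.$$
   Context: Throughout $0<q<1$. For $a\in\mathbb{C}$, $(a;q)_{\infty}=\prod_{k=0}^{\infty}(1-aq^{k})$ and $(a;q)_{n}=(a;q)_{\infty}/(aq^{n};q)_{\infty}$ for integers $n$ (so $(a;q)_n=\prod_{k=0}^{n-1}(1-aq^k)$ for $n\ge 0$). Ramanujan's entire function is $$A_{q}(z)=\sum_{k=0}^{\infty}\frac{q^{k^{2}}}{(q;q)_{k}}(-z)^{k}.$$ For nonzero $z\in\mathbb{C}$ and any base $p\in(0,1)$, the theta function is $\theta(z;p)=\sum_{k=-\infty}^{\infty}p^{k^{2}/2}z^{k}$; in particular $\theta(z;q^{2})=\sum_{k=-\infty}^{\infty}q^{k^{2}}z^{k}$. For real $x$, $\lfloor x\rfloor$ is the greatest integer $\le x$ and $\{x\}=x-\lfloor x\rfloor\in[0,1)$ is the fractional part. For an integer $n$, $\chi(n)=n-2\lfloor n/2\rfloor$, i.e. $\chi(n)=1$ if $n$ is odd and $0$ if $n$ is even. For a positive real number $t$, $\mathbb{S}(t)=\{\{nt\}:n\in\mathbb{N}\}$, where $\mathbb{N}$ is the set of positive integers. The displayed identities for $A_q(q^{-nt}u)$ define the remainders $r(n)$ and $e(n)$, whose bounds are then asserted. *)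

theory Defs
  imports "HOL-Analysis.Analysis"
begin

text \<open>
  The base is always a real number, while the argument may be real or complex: the error bounds
  use real values of the \<open>q\<close>-shifted factorial and of theta, the identities complex ones.
\<close>

definition qpoch_inf :: "'a::real_normed_field \<Rightarrow> real \<Rightarrow> 'a" where
  "qpoch_inf a q = (\<Prod>k. 1 - a * of_real (q ^ k))"

text \<open>
  A quotient of infinite products, hence only meaningful when the denominator does not vanish.
  This is the case for \<open>a = q\<close>, \<open>0 < q < 1\<close>, \<open>n \<ge> 0\<close>.
\<close>

definition qpoch :: "'a::real_normed_field \<Rightarrow> real \<Rightarrow> int \<Rightarrow> 'a" where
  "qpoch a q n = qpoch_inf a q / qpoch_inf (a * of_real (q powi n)) q"

definition ramanujan_A :: "real \<Rightarrow> complex \<Rightarrow> complex" where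
  "ramanujan_A q z =
     (\<Sum>k. of_real (q ^ (k\<^sup>2)) / qpoch (of_real q) q (int k) * (- z) ^ k)"

definition theta :: "'a::real_normed_field \<Rightarrow> real \<Rightarrow> 'a" where
  "theta z p = (\<Sum>\<^sub>\<infinity>k\<in>(UNIV :: int set). of_real (p powr ((of_int k)\<^sup>2 / 2)) * z powi k)"

definition chi :: "int \<Rightarrow> int" where
  "chi n = n - 2 * \<lfloor>real_of_int n / 2\<rfloor>"

definition frac_multiples :: "real \<Rightarrow> real set" where
  "frac_multiples t = {frac (real n * t) | n :: nat. 0 < n}"

definition nu :: "real \<Rightarrow> nat \<Rightarrow> int" where
  "nu q n = \<lfloor>- (q\<^sup>2 * ln (real n)) / ln q\<rfloor>"

end

theory Submission
  imports Defs "HOL-Real_Asymp.Real_Asymp"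
begin

text \<open>
  Put \<open>M = \<lfloor>m/2\<rfloor>\<close>, \<open>s = n t - 2 M\<close> and \<open>w = - 1 / u\<close>. Summing the series of \<open>A\<^sub>q\<close> in reverse order,
  \<open>k = M - j\<close>, pulls out the prefactor and leaves the sum over \<open>j \<le> M\<close> of
  \<open>q\<^bsup>j\<^sup>2 + s j\<^esup> w\<^bsup>j\<^esup> (q\<^bsup>M - j + 1\<^esup>; q)\<^sub>\<infinity>\<close>. Replacing the last factor by \<open>1\<close> and \<open>s\<close> by
  \<open>s\<^sub>0 = \<chi>(m) + \<lambda>\<close> (or \<open>\<chi>(m) + \<beta>\<close>) turns this into theta, at the cost of an error
  \<open>O(q\<^bsup>M\<^esup> + |s - s\<^sub>0|)\<close>. In the rational case \<open>s = s\<^sub>0\<close>, and the error \<open>O(q\<^bsup>m/2\<^esup>)\<close> is eventually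
  below any positive multiple of \<open>q\<^bsup>m/4\<^esup>\<close>; in the irrational case \<open>|s - s\<^sub>0| \<le> 3 / n\<close>, and the error
  \<open>O(1 / n)\<close> is eventually below any positive multiple of \<open>log n / n\<close>. So the constants of the
  stated bounds matter only through their positivity, and the remaining terms of the bounds only
  through being nonnegative.

  For the approximation \<open>|n t - m - \<alpha>| \<le> 3 / n\<close>, take \<open>|k t - h| < 1 / k\<close> with \<open>h, k\<close> coprime and \<open>k\<close> large,
  let \<open>Q\<close> be an integer nearest to \<open>k \<alpha>\<close>, and solve \<open>v h - x k = Q\<close> with \<open>|v| \<le> k / 2\<close>; then
  \<open>n = k + v\<close> and \<open>m = h + x\<close> work.
\<close>

section \<open>Inhomogeneous Diophantine approximation\<close>

lemma inhomogeneous_approximation: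
  fixes t \<alpha> :: real
  assumes "t \<notin> \<rat>"
  obtains n m :: int where "n > N" "\<bar>of_int n * t - of_int m - \<alpha>\<bar> \<le> 3 / of_int n"
proof -
  have "infinite (approx_set t)"
    using assms rational_iff_finite_approx_set by blast
  \<comment> \<open>The bound \<open>2 * \<bar>N\<bar>\<close> anticipates 2 n \<ge> k, which then
    yields both n > N and n > 0.\<close>
  from infinite_approx_set[OF this, of "2 * \<bar>N\<bar>"] obtain h k
    where hk: "(h, k) \<in> approx_set t" and kN: "k > 2 * \<bar>N\<bar>"
    by blast
  from hk have k: "k > 0" "coprime h k" and "\<bar>t - of_int h / of_int k\<bar> < 1 / (of_int k)\<^sup>2"
    by (auto simp: approx_set_def)
  then have "\<bar>t - of_int h / of_int k\<bar> * of_int k < 1 / (of_int k)\<^sup>2 * of_int k"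
    by (intro mult_strict_right_mono) auto
  also have "\<bar>t - of_int h / of_int k\<bar> * of_int k = \<bar>(t - of_int h / of_int k) * of_int k\<bar>"
    using k by (simp add: abs_mult)
  also have "(t - of_int h / of_int k) * of_int k = of_int k * t - of_int h"
    using k by (simp add: field_simps)
  finally have kt: "\<bar>of_int k * t - of_int h\<bar> \<le> 1 / of_int k"
    using k by (simp add: power2_eq_square)
  define Q where "Q = round (of_int k * \<alpha>)"
  have Q: "\<bar>of_int Q - of_int k * \<alpha>\<bar> \<le> 1 / 2"
    unfolding Q_def using of_int_round_abs_le[of "of_int k * \<alpha>"] by simp
  obtain a b where ab: "a * h + b * k = 1"
    using bezout_int[of h k] k by auto
  \<comment> \<open>By Bezout, a Q solves v h = Q modulo k. Subtracting the multiple of k nearest to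
    a Q makes |v| \<le> k / 2, and \<open>x\<close> is then chosen so that v h - x k = Q holds
    exactly.\<close>
  define r where "r = round (of_int (a * Q) / of_int k :: real)"
  define v where "v = a * Q - k * r"
  define x where "x = - (r * h + b * Q)"
  have "\<bar>of_int r - of_int (a * Q) / of_int k\<bar> \<le> (1 / 2 :: real)"
    unfolding r_def using of_int_round_abs_le by blast
  then have "\<bar>of_int r - of_int (a * Q) / of_int k\<bar> * of_int k \<le> 1 / 2 * (of_int k :: real)"
    using k by (intro mult_right_mono) auto
  also have "\<bar>of_int r - of_int (a * Q) / of_int k\<bar> * of_int k
      = \<bar>(of_int r - of_int (a * Q) / of_int k) * (of_int k :: real)\<bar>"
    using k by (simp add: abs_mult)
  also have "(of_int r - of_int (a * Q) / of_int k) * (of_int k :: real) = - of_int v"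
    using k by (simp add: field_simps v_def)
  finally have v: "\<bar>of_int v\<bar> \<le> (of_int k / 2 :: real)"
    by simp
  have "v * h - x * k = Q * (a * h + b * k)"
    unfolding v_def x_def by (simp add: algebra_simps)
  then have "v * h - x * k = Q"
    using ab by simp
  then have vx: "of_int v * of_int h - of_int x * of_int k = (of_int Q :: real)"
    by (metis of_int_diff of_int_mult)
  define n where "n = k + v"
  define m where "m = h + x"
  have n: "of_int n \<le> (3 / 2 * of_int k :: real)" "of_int n \<ge> (1 / 2 * of_int k :: real)"
    using v by (auto simp: n_def)
  from n(2) have "2 * n \<ge> k"
    by linarith
  with kN have nN: "n > N" "n > 0"
    using k(1) by linarith+
  \<comment> \<open>Both terms on the right are small: the first is at most 3/2 because n \<le> 3 k
    / 2, the second at most 1/2 by rounding. This gives the error 2 / k, and n \<le> 3 k / 2 again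
    turns it into 3 / n.\<close>
  have "of_int k * (of_int n * t - of_int m - \<alpha>)
      = of_int n * (of_int k * t - of_int h) + (of_int Q - of_int k * \<alpha>)"
    using vx by (simp add: n_def m_def algebra_simps)
  moreover have "\<bar>of_int n * (of_int k * t - of_int h)\<bar> \<le> 3 / 2"
  proof -
    have "\<bar>of_int n * (of_int k * t - of_int h)\<bar> = of_int n * \<bar>of_int k * t - of_int h\<bar>"
      using nN by (simp add: abs_mult)
    also have "\<dots> \<le> (3 / 2 * of_int k) * (1 / of_int k)"
      using kt n nN by (intro mult_mono) auto
    finally show ?thesis
      using k by simp
  qed
  ultimately have "\<bar>of_int k * (of_int n * t - of_int m - \<alpha>)\<bar> \<le> 2"
    using Q by linarith
  then have "of_int k * \<bar>of_int n * t - of_int m - \<alpha>\<bar> \<le> 2"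
    using k by (metis abs_mult abs_of_pos of_int_0_less_iff)
  then have "\<bar>of_int n * t - of_int m - \<alpha>\<bar> \<le> 2 / of_int k"
    using k by (simp add: pos_le_divide_eq mult.commute)
  also have "2 / of_int k \<le> 3 / (of_int n :: real)"
    using n nN k by (simp add: field_simps)
  finally show ?thesis
    using that nN by blast
qed

section \<open>Infinite q-shifted factorials with real parameter\<close>

lemma convergent_prod_qpoch:
  fixes a q :: real
  assumes q: "0 < q" "q < 1"
  shows "convergent_prod (\<lambda>k. 1 - a * q ^ k)"
  using q by (intro abs_convergent_prod_imp_convergent_prod summable_imp_abs_convergent_prod)
     (simp add: abs_mult power_abs[symmetric] summable_geometric summable_mult)

lemma qpoch_inf_LIMSEQ:
  fixes a q :: real
  assumes q: "0 < q" "q < 1"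
  shows "(\<lambda>n. \<Prod>k\<le>n. 1 - a * q ^ k) \<longlonglongrightarrow> qpoch_inf a q"
  using convergent_prod_LIMSEQ[OF convergent_prod_qpoch[OF q, of a]]
  by (simp add: qpoch_inf_def)

text \<open>Positive factors alone give only a nonnegative limit. That the limit is not 0 comes from
  the convergence of the product together with the absence of zero factors.\<close>

lemma qpoch_inf_pos:
  fixes a q :: real
  assumes q: "0 < q" "q < 1" and a: "a < 1"
  shows "0 < qpoch_inf a q"
proof -
  have factor: "0 < 1 - a * q ^ k" for k
  proof (cases "a \<le> 0")
    case True
    then have "a * q ^ k \<le> 0"
      using q by (intro mult_nonpos_nonneg) auto
    then show ?thesis by simp
  next
    case False
    then have "a * q ^ k \<le> a * 1"
      using q by (intro mult_left_mono power_le_one) auto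
    then show ?thesis
      using a by simp
  qed
  have "0 \<le> qpoch_inf a q"
    by (rule LIMSEQ_le_const[OF qpoch_inf_LIMSEQ[OF q]])
       (auto intro!: prod_nonneg less_imp_le[OF factor])
  moreover have "qpoch_inf a q \<noteq> 0"
    using prodinf_nonzero[OF convergent_prod_qpoch[OF q, of a]] less_imp_neq[OF factor]
    by (simp add: qpoch_inf_def)
  ultimately show ?thesis
    by simp
qed

text \<open>The lower bound is the Weierstrass inequality: a product of factors 1 - x_k with x_k in
  [0,1] is at least 1 minus the sum of the x_k, here a geometric series.\<close>

lemma qpoch_inf_bounds:
  fixes a q :: real
  assumes q: "0 < q" "q < 1" and a: "0 \<le> a" "a < 1"
  shows "qpoch_inf a q \<le> 1" and "1 - a / (1 - q) \<le> qpoch_inf a q"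
proof -
  have factor: "0 \<le> a * q ^ k" "a * q ^ k \<le> 1" for k
    using q a mult_mono[of a 1 "q ^ k" 1] by (auto simp: power_le_one)
  show "qpoch_inf a q \<le> 1"
    by (rule LIMSEQ_le_const2[OF qpoch_inf_LIMSEQ[OF q]])
       (auto intro!: exI[of _ 0] prod_le_1 simp: factor)
  have "1 - a / (1 - q) \<le> (\<Prod>k\<le>n. 1 - a * q ^ k)" for n
  proof -
    have "(\<Sum>k\<le>n. a * q ^ k) \<le> (\<Sum>k. a * q ^ k)"
      using q a by (intro sum_le_suminf) (auto simp: summable_geometric summable_mult)
    also have "\<dots> = a / (1 - q)"
      using q by (simp add: suminf_mult suminf_geometric summable_geometric)
    finally have "1 - a / (1 - q) \<le> 1 - (\<Sum>k\<le>n. a * q ^ k)"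
      by simp
    also have "\<dots> \<le> (\<Prod>k\<le>n. 1 - a * q ^ k)"
      by (rule Weierstrass_prod_ineq) (use factor in auto)
    finally show ?thesis .
  qed
  then show "1 - a / (1 - q) \<le> qpoch_inf a q"
    by (intro LIMSEQ_le_const[OF qpoch_inf_LIMSEQ[OF q]]) auto
qed

text \<open>The complex partial products are the embedded real ones. Identifying their limit with
  the infinite product requires a nonzero limit, which is where a < 1 enters.\<close>

lemma qpoch_inf_of_real:
  fixes a q :: real
  assumes q: "0 < q" "q < 1" and a: "a < 1"
  shows "qpoch_inf (of_real a :: complex) q = of_real (qpoch_inf a q)"
proof -
  have "(\<lambda>n. complex_of_real (\<Prod>k\<le>n. 1 - a * q ^ k))
      \<longlonglongrightarrow> of_real (qpoch_inf a q)"
    by (intro tendsto_of_real qpoch_inf_LIMSEQ q)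
  then have "(\<lambda>n. \<Prod>k\<le>n. 1 - of_real a * of_real (q ^ k) :: complex)
      \<longlonglongrightarrow> of_real (qpoch_inf a q)"
    by simp
  then show ?thesis
    unfolding qpoch_inf_def[of "of_real a"] using qpoch_inf_pos[OF assms]
    by (intro prodinf_eq_prod_lim) auto
qed

section \<open>Gaussian sums over the integers and theta\<close>

lemma summable_on_powr_abs_int:
  fixes q :: real
  assumes q: "0 < q" "q < 1"
  shows "(\<lambda>j::int. q powr \<bar>of_int j\<bar>) summable_on UNIV"
proof -
  have "(\<lambda>n. q ^ n) summable_on UNIV"
    using q by (intro norm_summable_imp_summable_on) (simp add: summable_geometric)
  then have "(\<lambda>n. q powr real n) summable_on UNIV"
    using q by (simp add: powr_realpow)
  moreover have "(\<lambda>j::int. q powr \<bar>of_int j\<bar>) \<circ> int = (\<lambda>n. q powr real n)"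
    and "(\<lambda>j::int. q powr \<bar>of_int j\<bar>) \<circ> (\<lambda>n. - int n) = (\<lambda>n. q powr real n)"
    by auto
  moreover have "inj int" "inj (\<lambda>n. - int n)"
    by (auto intro!: injI)
  ultimately have "(\<lambda>j::int. q powr \<bar>of_int j\<bar>) summable_on range int"
    and "(\<lambda>j::int. q powr \<bar>of_int j\<bar>) summable_on range (\<lambda>n. - int n)"
    by (metis summable_on_reindex)+
  \<comment> \<open>The integers are covered by two copies of the naturals, each carrying a
    geometric series; the overlap at 0 does no harm to summability.\<close>
  then have "(\<lambda>j::int. q powr \<bar>of_int j\<bar>) summable_on range int \<union> range (\<lambda>n. - int n)"
    by (rule summable_on_union)
  moreover have "range int \<union> range (\<lambda>n. - int n) = UNIV"
    by (auto intro: int_cases2)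
  ultimately show ?thesis
    by simp
qed

text \<open>Completing the square shows that the exponent is at least |j| - (c + 1)^2 / (4 a). As q
  < 1, the terms are dominated by a constant multiple of q^|j|.\<close>

lemma summable_on_gaussian_int:
  fixes q a c :: real
  assumes q: "0 < q" "q < 1" and a: "0 < a"
  shows "(\<lambda>j::int. q powr (a * (of_int j)\<^sup>2 - c * \<bar>of_int j\<bar>)) summable_on UNIV"
proof (rule summable_on_comparison_test)
  let ?K = "q powr (- ((c + 1)\<^sup>2 / (4 * a)))"
  show "(\<lambda>j::int. ?K * q powr \<bar>of_int j\<bar>) summable_on UNIV"
    by (intro summable_on_cmult_right summable_on_powr_abs_int q)
  fix j :: int
  have "0 \<le> (2 * a * \<bar>of_int j\<bar> - (c + 1))\<^sup>2 / (4 * a)"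
    using a by simp
  also have "\<dots> = a * (of_int j)\<^sup>2 - (c + 1) * \<bar>of_int j\<bar> + (c + 1)\<^sup>2 / (4 * a)"
    using a by (simp add: field_simps power2_eq_square)
  finally show "q powr (a * (of_int j)\<^sup>2 - c * \<bar>of_int j\<bar>) \<le> ?K * q powr \<bar>of_int j\<bar>"
    unfolding powr_add[symmetric] using q by (intro powr_mono') (auto simp: algebra_simps)
qed auto

text \<open>Writing |w|^j as a power of q lets the growth of all factors of a term be collected in
  one exponent.\<close>

lemma norm_powi_eq_powr:
  fixes w :: "'a::real_normed_field"
  assumes "0 < q" "q < 1" "w \<noteq> 0"
  shows "norm (w powi j) = q powr (ln (norm w) / ln q * of_int j)"
proof -
  have "q powr (ln (norm w) / ln q) = norm w"
    using assms by (simp add: powr_def)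
  then have "q powr (ln (norm w) / ln q * of_int j) = norm w powr of_int j"
    by (metis powr_powr)
  then show ?thesis
    using assms by (simp add: norm_power_int powr_real_of_int')
qed

text \<open>All terms are positive, so the sum is at least its term at j = 0, which is 1.
  Summability has to be shown first, since \<open>infsum\<close> of a non-summable family is 0 by
  convention.\<close>

lemma theta_pos:
  fixes x q :: real
  assumes q: "0 < q" "q < 1" and x: "0 < x"
  shows "0 < theta x q"
proof -
  let ?f = "\<lambda>j::int. q powr ((of_int j)\<^sup>2 / 2) * x powi j"
  define L where "L = ln x / ln q"
  have "x powi j = q powr (L * of_int j)" for j
    using norm_powi_eq_powr[of q x j] assms by (simp add: L_def)
  then have f: "?f j = q powr ((of_int j)\<^sup>2 / 2 + L * of_int j)" for j
    by (simp add: powr_add)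
  have "?f summable_on UNIV"
  proof (rule summable_on_comparison_test[OF summable_on_gaussian_int[OF q, of "1/2" "\<bar>L\<bar>"]])
    fix j :: int
    have "- (L * of_int j) \<le> \<bar>L\<bar> * \<bar>of_int j\<bar>"
      by (metis abs_ge_minus_self abs_mult)
    then show "?f j \<le> q powr (1 / 2 * (of_int j)\<^sup>2 - \<bar>L\<bar> * \<bar>of_int j\<bar>)"
      unfolding f using q by (intro powr_mono') auto
  qed (use f in auto)
  then have "sum ?f {0} \<le> infsum ?f UNIV"
    by (intro finite_sum_le_infsum) (use f in auto)
  then show ?thesis
    using q by (simp add: theta_def)
qed

text \<open>Base q^2 clears the 1/2 in the exponent of theta, and a factor q^s in the argument
  becomes the linear term s j; this matches theta with the reversed series.\<close>

lemma theta_square_term: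
  fixes w :: complex
  assumes q: "0 < q"
  shows "of_real ((q\<^sup>2) powr ((of_int j)\<^sup>2 / 2)) * (w * of_real (q powr s)) powi j
    = of_real (q powr ((of_int j)\<^sup>2 + s * of_int j)) * w powi j"
proof -
  have "(q\<^sup>2) powr ((of_int j)\<^sup>2 / 2) = q powr ((of_int j)\<^sup>2)"
    using q by (simp add: powr_powr flip: powr_numeral)
  moreover have "(q powr s) powi j = q powr (s * of_int j)"
    using q by (simp add: powr_powr flip: powr_real_of_int')
  ultimately show ?thesis
    by (simp add: power_int_mult_distrib powr_add flip: of_real_power_int)
qed

section \<open>Comparison of the truncated sum with theta\<close>

text \<open>Here q^x - q^y = q^x (1 - q^(y - x)), and 1 - e^z \<le> |z| with z = (y - x) ln q.
  Exchanging x and y gives the other sign.\<close>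

lemma abs_powr_diff_le:
  fixes q x y c :: real
  assumes q: "0 < q" "q < 1" and "\<bar>x\<bar> \<le> c" "\<bar>y\<bar> \<le> c"
  shows "\<bar>q powr x - q powr y\<bar> \<le> \<bar>x - y\<bar> * \<bar>ln q\<bar> * q powr (- c)"
proof -
  have *: "q powr x - q powr y \<le> \<bar>x - y\<bar> * \<bar>ln q\<bar> * q powr (- c)"
    if "\<bar>x\<bar> \<le> c" for x y
  proof -
    have "q powr x - q powr y = q powr x * (1 - q powr (y - x))"
      by (simp add: right_diff_distrib flip: powr_add)
    also have "\<dots> \<le> q powr x * \<bar>(y - x) * ln q\<bar>"
    proof (rule mult_left_mono)
      show "1 - q powr (y - x) \<le> \<bar>(y - x) * ln q\<bar>"
        using exp_ge_add_one_self[of "(y - x) * ln q"] q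
        unfolding powr_def if_not_P[OF less_imp_neq[OF q(1), symmetric]] by linarith
    qed simp
    also have "\<dots> \<le> q powr (- c) * \<bar>(y - x) * ln q\<bar>"
      using q that by (intro mult_right_mono powr_mono') auto
    finally show ?thesis
      by (simp add: abs_mult abs_minus_commute mult_ac)
  qed
  show ?thesis
    using *[of x y] *[of y x] assms by (auto simp: abs_minus_commute abs_le_iff)
qed

text \<open>The value \<open>0\<close> for \<open>j > M\<close> turns sums over \<open>j \<le> M\<close> into sums over all integers.\<close>

definition qpoch_tail :: "real \<Rightarrow> nat \<Rightarrow> int \<Rightarrow> real" where
  "qpoch_tail q M j = (if j \<le> int M then qpoch_inf (q ^ nat (int M - j + 1)) q else 0)"

text \<open>For j \<le> M the estimate is the Weierstrass bound with a = q^(M - j + 1). For j > M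
  the distance to 1 is exactly 1, while q^(M - j) \<ge> 1, so one bound serves all integers.\<close>

lemma qpoch_tail_bounds:
  assumes q: "0 < q" "q < 1"
  shows "0 \<le> qpoch_tail q M j" "qpoch_tail q M j \<le> 1"
    and "\<bar>qpoch_tail q M j - 1\<bar> \<le> q powr (real M - of_int j) / (1 - q)"
proof -
  have "0 \<le> qpoch_tail q M j \<and> qpoch_tail q M j \<le> 1 \<and>
    \<bar>qpoch_tail q M j - 1\<bar> \<le> q powr (real M - of_int j) / (1 - q)"
  proof (cases "j \<le> int M")
    case True
    define a where "a = q ^ nat (int M - j + 1)"
    have "nat (int M - j + 1) = Suc (nat (int M - j))"
      using True by simp
    then have a: "0 \<le> a" "a < 1"
      using q by (auto simp: a_def power_Suc_less_one simp del: power_Suc)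
    have "a = q powr (real M - of_int j + 1)"
      using q True by (simp add: a_def flip: powr_realpow)
    also have "\<dots> \<le> q powr (real M - of_int j)"
      using q by (intro powr_mono') auto
    finally have "a / (1 - q) \<le> q powr (real M - of_int j) / (1 - q)"
      using q by (intro divide_right_mono) auto
    then show ?thesis
      using True qpoch_inf_bounds[OF q a] qpoch_inf_pos[OF q a(2)]
      by (simp add: qpoch_tail_def flip: a_def)
  next
    case False
    then have "1 \<le> q powr (real M - of_int j)"
      using q powr_mono'[of "real M - of_int j" 0 q] by simp
    then have "1 * (1 - q) \<le> q powr (real M - of_int j) * 1"
      using q by (intro mult_mono) auto
    then show ?thesis
      using False q by (simp add: qpoch_tail_def pos_le_divide_eq)
  qed
  then show "0 \<le> qpoch_tail q M j" "qpoch_tail q M j \<le> 1"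
    and "\<bar>qpoch_tail q M j - 1\<bar> \<le> q powr (real M - of_int j) / (1 - q)"
    by auto
qed

text \<open>The difference splits into a change of s, weighted by the tail, and the deviation of the
  tail from 1. Each costs one extra factor q^(-|j|), which explains R + 1 in place of R.\<close>

lemma qpoch_tail_term_diff:
  fixes q s s0 R :: real
  assumes q: "0 < q" "q < 1" and s: "\<bar>s\<bar> \<le> R" "\<bar>s0\<bar> \<le> R"
  shows "\<bar>q powr (s * of_int j) * qpoch_tail q M j - q powr (s0 * of_int j)\<bar>
    \<le> (q ^ M + \<bar>s - s0\<bar>) / (1 - q) * q powr (- ((R + 1) * \<bar>of_int j\<bar>))"
proof -
  let ?j = "of_int j :: real" and ?G = "qpoch_tail q M j"
  let ?E = "q powr (- ((R + 1) * \<bar>?j\<bar>))"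
  note G = qpoch_tail_bounds[OF q, of M j]
  have sj: "\<bar>s * ?j\<bar> \<le> R * \<bar>?j\<bar>" "\<bar>s0 * ?j\<bar> \<le> R * \<bar>?j\<bar>"
    using s by (auto simp: abs_mult intro!: mult_right_mono)
  have E: "?E = q powr (- (R * \<bar>?j\<bar>)) * q powr (- \<bar>?j\<bar>)"
    by (simp add: algebra_simps flip: powr_add)
  \<comment> \<open>The linear factor left by the difference estimate is absorbed through y \<le>
    e^y with y = |j| |ln q|.\<close>
  have "\<bar>?j\<bar> * \<bar>ln q\<bar> \<le> q powr (- \<bar>?j\<bar>)"
    using q exp_ge_add_one_self[of "\<bar>?j\<bar> * \<bar>ln q\<bar>"] by (auto simp: powr_def abs_if mult_ac split: if_splits)
  then have "\<bar>s - s0\<bar> * (\<bar>?j\<bar> * \<bar>ln q\<bar>) * q powr (- (R * \<bar>?j\<bar>))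
      \<le> \<bar>s - s0\<bar> * q powr (- \<bar>?j\<bar>) * q powr (- (R * \<bar>?j\<bar>))"
    by (intro mult_right_mono mult_left_mono) auto
  then have "\<bar>s * ?j - s0 * ?j\<bar> * \<bar>ln q\<bar> * q powr (- (R * \<bar>?j\<bar>)) \<le> \<bar>s - s0\<bar> * ?E"
    unfolding E by (simp add: abs_mult mult_ac flip: left_diff_distrib)
  with abs_powr_diff_le[OF q sj]
  have d: "\<bar>q powr (s * ?j) - q powr (s0 * ?j)\<bar> \<le> \<bar>s - s0\<bar> * ?E"
    by linarith
  have "\<bar>q powr (s * ?j) - q powr (s0 * ?j)\<bar> * ?G \<le> \<bar>s - s0\<bar> * ?E * 1"
    using d G by (intro mult_mono) auto
  \<comment> \<open>The factor 1 / (1 - q) \<ge> 1 is inserted to give both error terms the same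
    denominator.\<close>
  also have "\<dots> \<le> \<bar>s - s0\<bar> * ?E * (1 / (1 - q))"
    using q by (intro mult_left_mono) auto
  finally have 1: "\<bar>q powr (s * ?j) - q powr (s0 * ?j)\<bar> * ?G \<le> \<bar>s - s0\<bar> / (1 - q) * ?E"
    by simp
  have "q powr (s0 * ?j) * \<bar>?G - 1\<bar>
      \<le> q powr (- (R * \<bar>?j\<bar>)) * (q powr (real M - ?j) / (1 - q))"
    using q sj G by (intro mult_mono powr_mono') auto
  also have "\<dots> \<le> q powr (- (R * \<bar>?j\<bar>)) * (q powr (real M - \<bar>?j\<bar>) / (1 - q))"
    using q by (intro mult_left_mono divide_right_mono powr_mono') auto
  also have "\<dots> = q ^ M / (1 - q) * ?E"
    unfolding E using q by (simp add: powr_diff powr_minus powr_realpow divide_inverse mult_ac)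
  finally have 2: "q powr (s0 * ?j) * \<bar>?G - 1\<bar> \<le> q ^ M / (1 - q) * ?E" .
  have "\<bar>q powr (s * ?j) * ?G - q powr (s0 * ?j)\<bar>
      = \<bar>(q powr (s * ?j) - q powr (s0 * ?j)) * ?G + q powr (s0 * ?j) * (?G - 1)\<bar>"
    by (simp add: algebra_simps)
  also have "\<dots> \<le> \<bar>q powr (s * ?j) - q powr (s0 * ?j)\<bar> * ?G + q powr (s0 * ?j) * \<bar>?G - 1\<bar>"
    using G by (intro order_trans[OF abs_triangle_ineq]) (simp add: abs_mult)
  also have "\<dots> \<le> q ^ M / (1 - q) * ?E + \<bar>s - s0\<bar> / (1 - q) * ?E"
    using 1 2 by simp
  finally show ?thesis
    by (simp add: add_divide_distrib algebra_simps)
qed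

text \<open>Termwise comparison with a summable majorant. The majorant depends only on q, w and R,
  hence C is uniform in M, s and s0, as the limit of large M demands.\<close>

lemma partial_theta_estimate:
  fixes w :: complex
  assumes q: "0 < q" "q < 1" and w: "w \<noteq> 0"
  obtains C where "C > 0"
    and "\<And>M s s0. \<bar>s\<bar> \<le> R \<Longrightarrow> \<bar>s0\<bar> \<le> R \<Longrightarrow>
      \<exists>S. ((\<lambda>j. of_real (q powr ((of_int j)\<^sup>2 + s * of_int j) * qpoch_tail q M j) * w powi j)
            has_sum S) UNIV \<and>
          norm (S - theta (w * of_real (q powr s0)) (q\<^sup>2)) \<le> C * (q ^ M + \<bar>s - s0\<bar>)"
proof -
  define L where "L = ln (norm w) / ln q"
  \<comment> \<open>The linear coefficient collects R + 1 from the termwise difference and |L| from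
    |w|^j; the square is the Gaussian factor common to both sums.\<close>
  define b where "b = (\<lambda>j::int. q powr (1 * (of_int j)\<^sup>2 - (R + 1 + \<bar>L\<bar>) * \<bar>of_int j\<bar>))"
  have b_summable: "b summable_on UNIV"
    unfolding b_def by (rule summable_on_gaussian_int[OF q]) simp
  have b_pos: "b j > 0" for j
    using q by (simp add: b_def)
  have b_sum: "infsum b UNIV > 0"
  proof -
    have "0 < sum b {0}"
      using b_pos by simp
    also have "\<dots> \<le> infsum b UNIV"
      using b_summable by (intro finite_sum_le_infsum) (auto simp: less_imp_le[OF b_pos])
    finally show ?thesis .
  qed
  have norm_w: "norm (w powi j) \<le> q powr (- (\<bar>L\<bar> * \<bar>of_int j\<bar>))" for j
  proof -
    have "- (\<bar>L\<bar> * \<bar>of_int j\<bar>) \<le> L * of_int j"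
      by (metis abs_ge_minus_self abs_mult minus_le_iff)
    then show ?thesis
      using norm_powi_eq_powr[OF q w, of j] q by (auto simp: L_def intro!: powr_mono')
  qed
  have b_eq: "b j = q powr ((of_int j)\<^sup>2) * q powr (- ((R + 1) * \<bar>of_int j\<bar>))
      * q powr (- (\<bar>L\<bar> * \<bar>of_int j\<bar>))" for j
    by (simp add: b_def algebra_simps flip: powr_add)
  define C where "C = infsum b UNIV / (1 - q)"
  show ?thesis
  proof (rule that)
    show "C > 0"
      using b_sum q by (simp add: C_def)
    fix M :: nat and s s0 :: real
    assume s: "\<bar>s\<bar> \<le> R" "\<bar>s0\<bar> \<le> R"
    let ?f = "\<lambda>j. of_real (q powr ((of_int j)\<^sup>2 + s * of_int j) * qpoch_tail q M j) * w powi j"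
    let ?g = "\<lambda>j. of_real (q powr ((of_int j)\<^sup>2 + s0 * of_int j)) * w powi j"
    let ?K = "(q ^ M + \<bar>s - s0\<bar>) / (1 - q)"
    have fg: "norm (?f j - ?g j) \<le> ?K * b j" for j
    proof -
      have "?f j - ?g j = of_real (q powr ((of_int j)\<^sup>2) *
          (q powr (s * of_int j) * qpoch_tail q M j - q powr (s0 * of_int j))) * w powi j"
        by (simp add: powr_add algebra_simps)
      then have "norm (?f j - ?g j) = q powr ((of_int j)\<^sup>2) *
          \<bar>q powr (s * of_int j) * qpoch_tail q M j - q powr (s0 * of_int j)\<bar> * norm (w powi j)"
        by (simp only: norm_mult norm_of_real abs_mult abs_of_nonneg[OF powr_ge_zero])
      also have "\<dots> \<le> q powr ((of_int j)\<^sup>2) * (?K * q powr (- ((R + 1) * \<bar>of_int j\<bar>)))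
          * q powr (- (\<bar>L\<bar> * \<bar>of_int j\<bar>))"
        using qpoch_tail_term_diff[OF q s, of j M] norm_w[of j] q
        by (intro mult_mono) auto
      finally show ?thesis
        unfolding b_eq by (simp only: mult_ac)
    qed
    have g: "norm (?g j) \<le> b j" for j
    proof -
      have "\<bar>s0 * of_int j\<bar> \<le> R * \<bar>of_int j\<bar>"
        using s by (auto simp: abs_mult intro!: mult_right_mono)
      then have "- ((R + 1) * \<bar>of_int j\<bar>) \<le> s0 * of_int j"
        by (simp add: algebra_simps)
      then have "q powr (s0 * of_int j) \<le> q powr (- ((R + 1) * \<bar>of_int j\<bar>))"
        using q by (intro powr_mono') auto
      then show ?thesis
        unfolding b_eq norm_mult norm_of_real powr_add abs_mult using norm_w[of j]
        by (intro mult_mono) auto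
    qed
    have g_summable: "?g summable_on UNIV"
      by (rule abs_summable_summable, rule Infinite_Sum.abs_summable_on_comparison_test'[OF b_summable g])
    have diff_abs: "(\<lambda>j. norm (?f j - ?g j)) summable_on UNIV"
      by (rule Infinite_Sum.abs_summable_on_comparison_test'[OF summable_on_cmult_right[OF b_summable] fg])
    have diff_summable: "(\<lambda>j. ?f j - ?g j) summable_on UNIV"
      by (rule abs_summable_summable[OF diff_abs])
    have "(\<lambda>j. (?f j - ?g j) + ?g j) summable_on UNIV"
      by (intro summable_on_add diff_summable g_summable)
    then have f_summable: "?f summable_on UNIV"
      by simp
    have theta: "theta (w * of_real (q powr s0)) (q\<^sup>2) = infsum ?g UNIV"
      unfolding theta_def using theta_square_term[OF q(1), of _ w s0] by simp
    have "norm (infsum ?f UNIV - infsum ?g UNIV) = norm (infsum (\<lambda>j. ?f j - ?g j) UNIV)"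
      using infsum_add[OF diff_summable g_summable] by simp
    also have "\<dots> \<le> infsum (\<lambda>j. norm (?f j - ?g j)) UNIV"
      by (rule norm_infsum_bound[OF diff_abs])
    also have "\<dots> \<le> infsum (\<lambda>j. ?K * b j) UNIV"
      by (intro infsum_mono diff_abs summable_on_cmult_right b_summable fg)
    also have "\<dots> = C * (q ^ M + \<bar>s - s0\<bar>)"
      unfolding infsum_cmult_right' by (simp add: C_def)
    finally show "\<exists>S. (?f has_sum S) UNIV \<and>
        norm (S - theta (w * of_real (q powr s0)) (q\<^sup>2)) \<le> C * (q ^ M + \<bar>s - s0\<bar>)"
      unfolding theta by (intro exI[of _ "infsum ?f UNIV"] conjI has_sum_infsum f_summable)
  qed
qed

section \<open>Reversal of the series of \<open>ramanujan_A\<close>\<close>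

text \<open>With j = M - k the exponents satisfy j^2 + (x - 2 M) j - M (x - M) = k^2 - x k, and the
  powers of u combine to (-u)^k. The prefactor therefore turns each term of S into a term of the
  series.\<close>

lemma ramanujan_A_reversed:
  fixes u :: complex and x :: real
  assumes q: "0 < q" "q < 1" and u: "u \<noteq> 0"
    and S: "((\<lambda>j. of_real (q powr ((of_int j)\<^sup>2 + (x - 2 * real M) * of_int j) * qpoch_tail q M j)
            * (- inverse u) powi j) has_sum S) UNIV"
  shows "ramanujan_A q (of_real (q powr (- x)) * u) =
    (- u) ^ M * S / (qpoch_inf (of_real q) q * of_real (q powr (real M * (x - real M))))"
proof -
  let ?f = "\<lambda>j. of_real (q powr ((of_int j)\<^sup>2 + (x - 2 * real M) * of_int j) * qpoch_tail q M j)
            * (- inverse u) powi j"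
  let ?D = "(- u) ^ M / (qpoch_inf (of_real q) q * of_real (q powr (real M * (x - real M))))"
  \<comment> \<open>For j > M the factor \<open>qpoch_tail\<close> is 0, so only j \<le> M remain,
    and then k = M - j runs through all naturals.\<close>
  have "(?f has_sum S) {..int M}"
    using S by (rule iffD1[OF has_sum_cong_neutral, rotated -1]) (auto simp: qpoch_tail_def)
  then have "((\<lambda>k. ?f (int M - int k)) has_sum S) UNIV"
    by (rule iffD2[OF has_sum_reindex_bij_witness[of _ "\<lambda>j. nat (int M - j)" "\<lambda>k. int M - int k"], rotated -1])
       auto
  then have "((\<lambda>k. ?D * ?f (int M - int k)) has_sum (?D * S)) UNIV"
    by (rule has_sum_cmult_right)
  then have "(\<lambda>k. ?D * ?f (int M - int k)) sums (?D * S)"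
    by (rule has_sum_imp_sums)
  moreover have "?D * ?f (int M - int k) =
    of_real (q ^ (k\<^sup>2)) / qpoch (of_real q) q (int k) * (- (of_real (q powr (- x)) * u)) ^ k" for k
  proof -
    \<comment> \<open>At j = M - k the tail starts at q^(k + 1), and its quotient by (q;q)_inf is
      the reciprocal of (q;q)_k.\<close>
    let ?P = "qpoch_inf (of_real (q ^ Suc k)) q :: complex"
    have P: "of_real (qpoch_tail q M (int M - int k)) = ?P"
      using q qpoch_inf_of_real[OF q power_Suc_less_one[OF q, of k]]
      by (simp add: qpoch_tail_def nat_add_distrib)
    have "(- inverse u) powi (int M - int k) = (- u) powi (int k - int M)"
      by (metis inverse_minus_eq minus_diff_eq power_int_inverse power_int_minus)
    then have "(- u) ^ M * (- inverse u) powi (int M - int k) = (- u) powi int M * (- u) powi (int k - int M)"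
      by simp
    also have "\<dots> = (- u) ^ k"
      using u power_int_add[of "- u" "int M" "int k - int M"] by simp
    finally have U: "(- u) ^ M * (- inverse u) powi (int M - int k) = (- u) ^ k" .
    define e where "e = (of_int (int M - int k))\<^sup>2 + (x - 2 * real M) * of_int (int M - int k)"
    have "e - real M * (x - real M) = real (k\<^sup>2) + (- x) * real k"
      by (simp add: e_def power2_eq_square algebra_simps)
    then have "q powr e / q powr (real M * (x - real M)) = q powr real (k\<^sup>2) * q powr (- x * real k)"
      by (metis powr_add powr_diff)
    also have "\<dots> = q ^ (k\<^sup>2) * (q powr (- x)) ^ k"
      using q unfolding powr_realpow[OF q(1)] powr_powr[symmetric] by (simp add: powr_realpow)
    finally have e: "of_real (q powr e) / of_real (q powr (real M * (x - real M)))
        = (of_real (q ^ (k\<^sup>2)) * of_real (q powr (- x)) ^ k :: complex)"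
      by (metis of_real_divide of_real_mult of_real_power)
    have "?D * ?f (int M - int k) =
        (of_real (q powr e) / of_real (q powr (real M * (x - real M)))) *
        ((- u) ^ M * (- inverse u) powi (int M - int k)) *
        (of_real (qpoch_tail q M (int M - int k)) / qpoch_inf (of_real q) q)"
      unfolding e_def by (simp add: mult_ac)
    also have "\<dots> = (of_real (q ^ (k\<^sup>2)) * of_real (q powr (- x)) ^ k) * (- u) ^ k * (?P / qpoch_inf (of_real q) q)"
      unfolding e U P ..
    also have "\<dots> = of_real (q ^ (k\<^sup>2)) / qpoch (of_real q) q (int k) * (- (of_real (q powr (- x)) * u)) ^ k"
    proof -
      have "qpoch (of_real q) q (int k) = qpoch_inf (of_real q) q / ?P"
        by (simp add: qpoch_def)
      moreover have "(- (of_real (q powr (- x)) * u)) ^ k = of_real (q powr (- x)) ^ k * (- u) ^ k"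
        unfolding mult_minus_right[symmetric] by (rule power_mult_distrib)
      ultimately show ?thesis
        by simp
    qed
    finally show ?thesis .
  qed
  ultimately show ?thesis
    unfolding ramanujan_A_def by (simp add: sums_iff)
qed

text \<open>The error e is by definition S minus theta, so the identity is exact and only the size
  of e is estimated.\<close>

lemma ramanujan_A_theta_estimate:
  fixes u :: complex
  assumes q: "0 < q" "q < 1" and u: "u \<noteq> 0"
  obtains C where "C > 0"
    and "\<And>M x s0. \<bar>x - 2 * real M\<bar> \<le> R \<Longrightarrow> \<bar>s0\<bar> \<le> R \<Longrightarrow>
      \<exists>e. ramanujan_A q (of_real (q powr (- x)) * u) =
          (- u) ^ M * (theta (- inverse u * of_real (q powr s0)) (q\<^sup>2) + e) /
            (qpoch_inf (of_real q) q * of_real (q powr (real M * (x - real M)))) \<and>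
        norm e \<le> C * (q ^ M + \<bar>x - 2 * real M - s0\<bar>)"
proof -
  have "- inverse u \<noteq> 0"
    using u by simp
  from partial_theta_estimate[OF q this, of R] obtain C where C: "C > 0"
    "\<And>M s s0. \<bar>s\<bar> \<le> R \<Longrightarrow> \<bar>s0\<bar> \<le> R \<Longrightarrow>
      \<exists>S. ((\<lambda>j. of_real (q powr ((of_int j)\<^sup>2 + s * of_int j) * qpoch_tail q M j) * (- inverse u) powi j)
            has_sum S) UNIV \<and>
          norm (S - theta (- inverse u * of_real (q powr s0)) (q\<^sup>2)) \<le> C * (q ^ M + \<bar>s - s0\<bar>)"
    by blast
  show ?thesis
  proof (rule that[OF C(1)])
    fix M :: nat and x s0 :: real
    assume "\<bar>x - 2 * real M\<bar> \<le> R" "\<bar>s0\<bar> \<le> R"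
    from C(2)[OF this, of M] obtain S where
      S: "((\<lambda>j. of_real (q powr ((of_int j)\<^sup>2 + (x - 2 * real M) * of_int j) * qpoch_tail q M j)
            * (- inverse u) powi j) has_sum S) UNIV"
      and le: "norm (S - theta (- inverse u * of_real (q powr s0)) (q\<^sup>2)) \<le> C * (q ^ M + \<bar>x - 2 * real M - s0\<bar>)"
      by blast
    show "\<exists>e. ramanujan_A q (of_real (q powr (- x)) * u) =
          (- u) ^ M * (theta (- inverse u * of_real (q powr s0)) (q\<^sup>2) + e) /
            (qpoch_inf (of_real q) q * of_real (q powr (real M * (x - real M)))) \<and>
        norm e \<le> C * (q ^ M + \<bar>x - 2 * real M - s0\<bar>)"
      using ramanujan_A_reversed[OF q u S] le
      by (intro exI[of _ "S - theta (- inverse u * of_real (q powr s0)) (q\<^sup>2)"]) simp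
  qed
qed

section \<open>Infinitely many admissible pairs\<close>

lemma infinite_pairs:
  assumes "\<And>N::nat. \<exists>n m. N < n \<and> P n m"
  shows "infinite {(n :: nat, m :: nat). P n m}"
proof
  assume "finite {(n, m). P n m}"
  then have "finite (fst ` {(n, m). P n m})"
    by (rule finite_imageI)
  then obtain N where "\<forall>n \<in> fst ` {(n, m). P n m}. n \<le> N"
    using finite_nat_set_iff_bounded_le by blast
  with assms[of N] show False
    by force
qed

lemma rational_pairs_infinite:
  fixes t l :: real
  assumes t: "0 < t" "t \<in> \<rat>" and l: "l \<in> frac_multiples t"
  shows "infinite {(n :: nat, m :: nat). 0 < n \<and> 0 < m \<and> t * real n = real m + l}"
proof (rule infinite_pairs)
  fix N :: nat
  obtain n0 :: nat where l: "l = frac (real n0 * t)"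
    using l by (auto simp: frac_multiples_def)
  obtain a b :: int where b: "b > 0" and ab: "t = of_int a / of_int b"
    using t by (meson Rats_cases')
  from t b ab have a: "a > 0"
    by (simp add: zero_less_divide_iff)
  \<comment> \<open>Adding a multiple of the denominator b to n0 changes n t by an integer and so
    keeps the fractional part. \<open>Suc N\<close> rather than \<open>N\<close> ensures n > N and,
    even if n0 t < 1, m > 0.\<close>
  define n where "n = n0 + nat b * Suc N"
  define m where "m = nat (\<lfloor>real n0 * t\<rfloor> + a * int (Suc N))"
  have fl: "\<lfloor>real n0 * t\<rfloor> \<ge> 0"
    using t by simp
  have ap: "a * int (Suc N) > 0"
    using a by (intro mult_pos_pos) auto
  have "1 * Suc N \<le> nat b * Suc N"
    using b by (intro mult_right_mono) auto
  then have "N < n"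
    by (simp add: n_def)
  moreover have "0 < m"
    unfolding m_def zero_less_nat_eq using fl ap by linarith
  moreover have "t * real n = real m + l"
  proof -
    have "real n = real n0 + of_int b * real (Suc N)"
      using b by (simp add: n_def algebra_simps)
    then have "t * real n = real n0 * t + of_int a * real (Suc N)"
      using b ab by (simp add: field_simps)
    moreover have "real m = of_int (\<lfloor>real n0 * t\<rfloor> + a * int (Suc N))"
      using fl ap unfolding m_def by (intro of_nat_nat) linarith
    ultimately show ?thesis
      by (simp add: l frac_def)
  qed
  ultimately show "\<exists>n m. N < n \<and> 0 < n \<and> 0 < m \<and> t * real n = real m + l"
    by (intro exI[of _ n] exI[of _ m]) auto
qed

lemma irrational_pairs_infinite:
  fixes t \<beta> :: real
  assumes t: "0 < t" "t \<notin> \<rat>"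
  shows "infinite {(n :: nat, m :: nat). 0 < n \<and> 0 < m \<and>
          (\<exists>\<gamma> :: real. real n * t = real m + \<beta> + \<gamma> \<and> \<bar>\<gamma>\<bar> \<le> 3 / real n)}"
proof (rule infinite_pairs)
  fix N :: nat
  \<comment> \<open>Beyond (\<beta> + 3) / t one has n t > \<beta> + 3, which forces m > 0 because
    the error is at most 3 / n \<le> 3.\<close>
  define N' where "N' = int N + \<bar>\<lceil>(\<beta> + 3) / t\<rceil>\<bar> + 1"
  obtain n m :: int where nm: "n > N'" "\<bar>of_int n * t - of_int m - \<beta>\<bar> \<le> 3 / of_int n"
    using inhomogeneous_approximation[OF t(2)] by blast
  have n: "n > int N" "n \<ge> 1" "n > \<lceil>(\<beta> + 3) / t\<rceil>"
    using nm(1) unfolding N'_def by linarith+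
  from n(3) have "(\<beta> + 3) / t < of_int n"
    by linarith
  then have "\<beta> + 3 < of_int n * t"
    using t by (simp add: pos_divide_less_eq)
  moreover have "3 / real_of_int n \<le> 3"
    using n(2) by (simp add: field_simps)
  ultimately have "of_int m > (0::real)"
    using nm(2) by linarith
  then have "m > 0"
    by simp
  with n nm(2) show "\<exists>n m. N < n \<and> 0 < n \<and> 0 < m \<and>
      (\<exists>\<gamma>::real. real n * t = real m + \<beta> + \<gamma> \<and> \<bar>\<gamma>\<bar> \<le> 3 / real n)"
    by (intro exI[of _ "nat n"] exI[of _ "nat m"])
       (auto intro!: exI[of _ "of_int n * t - of_int m - \<beta>"])
qed

section \<open>Error bounds in the rational and the irrational case\<close>

lemma real_eq_chi: "real m = 2 * real (m div 2) + of_int (chi (int m))"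
  and chi_bounds: "0 \<le> chi (int m)" "chi (int m) \<le> 1"
proof -
  have "\<lfloor>real_of_int (int m) / 2\<rfloor> = int m div 2"
    using floor_divide_of_int_eq[of "int m" 2] by simp
  then have "chi (int m) = int m - 2 * (int m div 2)"
    by (simp add: chi_def)
  then have *: "chi (int m) = int m mod 2"
    by (simp add: minus_mult_div_eq_mod)
  then show "0 \<le> chi (int m)" "chi (int m) \<le> 1"
    by auto
  show "real m = 2 * real (m div 2) + of_int (chi (int m))"
    unfolding * by (metis div_mult_mod_eq mult.commute of_int_of_nat_eq of_nat_add of_nat_mult of_nat_numeral zmod_int)
qed

lemma power_div2_le:
  fixes q :: real
  assumes q: "0 < q" "q < 1"
  shows "q ^ (m div 2) \<le> q powr ((real m - 1) / 2)"
  using q real_eq_chi[of m] chi_bounds[of m] by (auto simp flip: powr_realpow intro!: powr_mono')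

text \<open>Here x - 2 M equals chi(m) + l exactly, which leaves the error C q^M; the radius 2 is
  large enough because chi(m) + l < 2. The remainder can depend on n alone since m = t n - l is
  determined by n.\<close>

lemma rational_case:
  fixes q t l K :: real and u :: complex
  assumes q: "0 < q" "q < 1" and u: "u \<noteq> 0" and t: "0 < t" and l: "0 \<le> l" "l < 1" and K: "K > 0"
  shows "\<exists>r :: nat \<Rightarrow> complex.
          (\<forall>n m :: nat. 0 < n \<and> 0 < m \<and> t * real n = real m + l \<longrightarrow>
             ramanujan_A q (of_real (q powr (- (real n * t))) * u) =
               (- u) ^ (m div 2) *
                 (theta (- inverse u * of_real (q powr (of_int (chi (int m)) + l))) (q\<^sup>2) + r n) /
               (qpoch_inf (of_real q) q *
                 of_real (q powr (real (m div 2) * (real n * t - real (m div 2)))))) \<and>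
          (\<exists>N. \<forall>n m :: nat. N \<le> n \<and> 0 < n \<and> 0 < m \<and> t * real n = real m + l \<longrightarrow>
             norm (r n) \<le> K * q powr (real m / 4))"
proof -
  from ramanujan_A_theta_estimate[OF q u, of 2] obtain C where C: "C > 0"
    and est: "\<And>M x s0. \<bar>x - 2 * real M\<bar> \<le> 2 \<Longrightarrow> \<bar>s0\<bar> \<le> 2 \<Longrightarrow>
      \<exists>e. ramanujan_A q (of_real (q powr (- x)) * u) =
          (- u) ^ M * (theta (- inverse u * of_real (q powr s0)) (q\<^sup>2) + e) /
            (qpoch_inf (of_real q) q * of_real (q powr (real M * (x - real M)))) \<and>
        norm e \<le> C * (q ^ M + \<bar>x - 2 * real M - s0\<bar>)"
    by blast
  define P where "P = (\<lambda>n m e. ramanujan_A q (of_real (q powr (- (real n * t))) * u) =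
               (- u) ^ (m div 2) *
                 (theta (- inverse u * of_real (q powr (of_int (chi (int m)) + l))) (q\<^sup>2) + e) /
               (qpoch_inf (of_real q) q *
                 of_real (q powr (real (m div 2) * (real n * t - real (m div 2)))))
               \<and> norm e \<le> C * q ^ (m div 2))"
  have ex: "\<exists>e. P n m e" if "t * real n = real m + l" for n m :: nat
  proof -
    have x: "real n * t = 2 * real (m div 2) + (of_int (chi (int m)) + l)"
      using that real_eq_chi[of m] by (simp add: mult.commute)
    then show ?thesis
      unfolding P_def using est[of "real n * t" "m div 2" "of_int (chi (int m)) + l"] l chi_bounds[of m]
      by auto
  qed
  define r where "r = (\<lambda>n. SOME e. P n (nat \<lfloor>real n * t - l\<rfloor>) e)"
  have r: "P n m (r n)" if "t * real n = real m + l" for n m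
  proof -
    have "real n * t - l = real m"
      using that by (simp add: mult.commute)
    then have "nat \<lfloor>real n * t - l\<rfloor> = m"
      by simp
    then show ?thesis
      unfolding r_def using someI_ex[OF ex[OF that]] by simp
  qed
  \<comment> \<open>The quotient decays like q^(x / 4), so it falls below K whatever the size of
    C.\<close>
  have "filterlim (\<lambda>x::real. C * q powr ((x - 1) / 2) / q powr (x / 4)) (nhds 0) at_top"
    using q by real_asymp
  then have "\<forall>\<^sub>F x in at_top. C * q powr ((x - 1) / 2) / q powr (x / 4) < K"
    using K by (rule order_tendstoD(2))
  then obtain X where X: "\<And>x. x \<ge> X \<Longrightarrow> C * q powr ((x - 1) / 2) / q powr (x / 4) < K"
    by (auto simp: eventually_at_top_linorder)
  have bound: "norm (r n) \<le> K * q powr (real m / 4)"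
    if n: "nat \<lceil>(X + 1) / t\<rceil> \<le> n" and eq: "t * real n = real m + l" for n m
  proof -
    from n have "(X + 1) / t \<le> real n"
      by linarith
    then have "real m \<ge> X"
      using eq l t by (simp add: pos_divide_le_eq mult.commute)
    from X[OF this] have "C * q powr ((real m - 1) / 2) < K * q powr (real m / 4)"
      using q by (simp add: pos_divide_less_eq)
    moreover have "norm (r n) \<le> C * q powr ((real m - 1) / 2)"
      using r[OF eq] mult_left_mono[OF power_div2_le[OF q, of m] less_imp_le[OF C]]
      unfolding P_def by linarith
    ultimately show ?thesis
      by linarith
  qed
  show ?thesis
    by (intro exI[of _ r] conjI exI[of _ "nat \<lceil>(X + 1) / t\<rceil>"] allI impI; elim conjE)
       (erule r[unfolded P_def, THEN conjunct1], erule (1) bound)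
qed

text \<open>The shift \<open>\<gamma>\<close> contributes at most 3 / n, which is o(log n / n), and
  q^M decays exponentially in n. The remainder depends on m as well, since for small n several m may
  lie within the tolerance 3 / n.\<close>

lemma irrational_case:
  fixes q t \<beta> K :: real and u :: complex
  assumes q: "0 < q" "q < 1" and u: "u \<noteq> 0" and t: "0 < t" and \<beta>: "0 \<le> \<beta>" "\<beta> < 1" and K: "K > 0"
  shows "\<exists>e :: nat \<Rightarrow> nat \<Rightarrow> complex.
          (\<forall>n m :: nat. 0 < n \<and> 0 < m \<and>
             (\<exists>\<gamma> :: real. real n * t = real m + \<beta> + \<gamma> \<and> \<bar>\<gamma>\<bar> \<le> 3 / real n) \<longrightarrow>
             ramanujan_A q (of_real (q powr (- (real n * t))) * u) =
               (- u) ^ (m div 2) *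
                 (theta (- inverse u * of_real (q powr (of_int (chi (int m)) + \<beta>))) (q\<^sup>2) + e n m) /
               (qpoch_inf (of_real q) q *
                 of_real (q powr (real (m div 2) * (real n * t - real (m div 2)))))) \<and>
          (\<exists>N. \<forall>n m :: nat. N \<le> n \<and> 0 < n \<and> 0 < m \<and>
             (\<exists>\<gamma> :: real. real n * t = real m + \<beta> + \<gamma> \<and> \<bar>\<gamma>\<bar> \<le> 3 / real n) \<longrightarrow>
             norm (e n m) \<le> K * (ln (real n) / real n))"
proof -
  \<comment> \<open>The radius 5 covers chi(m) + \<beta> + \<gamma>, with the summands at most 1, 1
    and 3.\<close>
  from ramanujan_A_theta_estimate[OF q u, of 5] obtain C where C: "C > 0"
    and est: "\<And>M x s0. \<bar>x - 2 * real M\<bar> \<le> 5 \<Longrightarrow> \<bar>s0\<bar> \<le> 5 \<Longrightarrow>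
      \<exists>e. ramanujan_A q (of_real (q powr (- x)) * u) =
          (- u) ^ M * (theta (- inverse u * of_real (q powr s0)) (q\<^sup>2) + e) /
            (qpoch_inf (of_real q) q * of_real (q powr (real M * (x - real M)))) \<and>
        norm e \<le> C * (q ^ M + \<bar>x - 2 * real M - s0\<bar>)"
    by blast
  define P where "P = (\<lambda>n m e. ramanujan_A q (of_real (q powr (- (real n * t))) * u) =
               (- u) ^ (m div 2) *
                 (theta (- inverse u * of_real (q powr (of_int (chi (int m)) + \<beta>))) (q\<^sup>2) + e) /
               (qpoch_inf (of_real q) q *
                 of_real (q powr (real (m div 2) * (real n * t - real (m div 2)))))
               \<and> norm e \<le> C * (q ^ (m div 2) + 3 / real n))"
  define near where "near = (\<lambda>n m :: nat. 0 < n \<and>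
    (\<exists>\<gamma> :: real. real n * t = real m + \<beta> + \<gamma> \<and> \<bar>\<gamma>\<bar> \<le> 3 / real n))"
  have near_le: "\<bar>real n * t - real m - \<beta>\<bar> \<le> 3 / real n" "3 / real n \<le> 3" if "near n m" for n m
    using that by (auto simp: near_def field_simps)
  have ex: "\<exists>e. P n m e" if "near n m" for n m :: nat
  proof -
    note nm = near_le[OF that] real_eq_chi[of m] chi_bounds[of m]
    have "0 \<le> real_of_int (chi (int m))" "real_of_int (chi (int m)) \<le> 1"
      using nm by auto
    then have "\<bar>real n * t - 2 * real (m div 2)\<bar> \<le> 5" "\<bar>of_int (chi (int m)) + \<beta>\<bar> \<le> 5"
      using nm \<beta> by linarith+
    from est[OF this] obtain e where e: "ramanujan_A q (of_real (q powr (- (real n * t))) * u) =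
               (- u) ^ (m div 2) *
                 (theta (- inverse u * of_real (q powr (of_int (chi (int m)) + \<beta>))) (q\<^sup>2) + e) /
               (qpoch_inf (of_real q) q *
                 of_real (q powr (real (m div 2) * (real n * t - real (m div 2)))))"
      "norm e \<le> C * (q ^ (m div 2) + \<bar>real n * t - 2 * real (m div 2) - (of_int (chi (int m)) + \<beta>)\<bar>)"
      by blast
    have "\<bar>real n * t - 2 * real (m div 2) - (of_int (chi (int m)) + \<beta>)\<bar> \<le> 3 / real n"
      using nm by linarith
    then have "C * (q ^ (m div 2) + \<bar>real n * t - 2 * real (m div 2) - (of_int (chi (int m)) + \<beta>)\<bar>)
        \<le> C * (q ^ (m div 2) + 3 / real n)"
      using C by (intro mult_left_mono) auto
    with e show ?thesis
      unfolding P_def by (intro exI[of _ e]) linarith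
  qed
  define e where "e = (\<lambda>n m. SOME e. P n m e)"
  have e: "P n m (e n m)" if "near n m" for n m
    unfolding e_def using someI_ex[OF ex[OF that]] .
  \<comment> \<open>The decay rate of q^(n t / 2) as an exponential in n; naming it gives the
    asymptotic procedure a single positive parameter.\<close>
  define c where "c = - ln q * t / 2"
  have "c > 0"
    using q t by (auto simp: c_def mult_neg_pos)
  then have "filterlim (\<lambda>n::nat. C * (exp (- (c * real n)) * q powr (- 5 / 2) + 3 / real n)
      / (ln (real n) / real n)) (nhds 0) at_top"
    by real_asymp
  moreover have "exp (- (c * real n)) * q powr (- 5 / 2) = q powr ((real n * t - 5) / 2)" for n
    using q by (simp add: c_def powr_def diff_divide_distrib algebra_simps flip: exp_add)
  ultimately have "filterlim (\<lambda>n::nat. C * (q powr ((real n * t - 5) / 2) + 3 / real n)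
      / (ln (real n) / real n)) (nhds 0) at_top"
    by (simp only:)
  then have "\<forall>\<^sub>F n::nat in at_top.
      C * (q powr ((real n * t - 5) / 2) + 3 / real n) / (ln (real n) / real n) < K"
    using K by (rule order_tendstoD(2))
  then obtain N where N: "\<And>n. n \<ge> N \<Longrightarrow>
      C * (q powr ((real n * t - 5) / 2) + 3 / real n) / (ln (real n) / real n) < K"
    by (auto simp: eventually_at_top_linorder)
  have bound: "norm (e n m) \<le> K * (ln (real n) / real n)"
    \<comment> \<open>From n \<ge> 2 the quantity log n / n is positive, so the quotient bound can
      be cleared of its denominator.\<close>
    if n: "max N 2 \<le> n" and near: "near n m" for n m
  proof -
    have pos: "0 < ln (real n) / real n"
      using n by simp
    have "q ^ (m div 2) \<le> q powr ((real m - 1) / 2)"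
      by (rule power_div2_le[OF q])
    \<comment> \<open>The offset 5 arises from m - 1 \<ge> n t - \<beta> - 3 / n - 1 \<ge> n t -
      5.\<close>
    also have "\<dots> \<le> q powr ((real n * t - 5) / 2)"
      using q \<beta> near_le[OF near] by (intro powr_mono') auto
    finally have "C * (q ^ (m div 2) + 3 / real n) \<le> C * (q powr ((real n * t - 5) / 2) + 3 / real n)"
      using C by (intro mult_left_mono) auto
    also have "\<dots> < K * (ln (real n) / real n)"
      using N[of n] n pos_divide_less_eq[OF pos] by auto
    finally show ?thesis
      using e[OF near] by (auto simp: P_def)
  qed
  show ?thesis
    using e bound unfolding P_def near_def
    by (intro exI[of _ e] conjI exI[of _ "max N 2"] allI impI) blast+
qed

theorem theorem2p1:
  fixes q :: real and u :: complex
  assumes q: "0 < q" "q < 1"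
    and u: "u \<noteq> 0"
  shows
    "(\<forall>t l :: real. 0 < t \<and> t \<in> \<rat> \<and> l \<in> frac_multiples t \<longrightarrow>
        infinite {(n :: nat, m :: nat). 0 < n \<and> 0 < m \<and> t * real n = real m + l} \<and>
        (\<exists>r :: nat \<Rightarrow> complex.
          (\<forall>n m :: nat. 0 < n \<and> 0 < m \<and> t * real n = real m + l \<longrightarrow>
             ramanujan_A q (of_real (q powr (- (real n * t))) * u) =
               (- u) ^ (m div 2) *
                 (theta (- inverse u * of_real (q powr (of_int (chi (int m)) + l))) (q\<^sup>2) + r n) /
               (qpoch_inf (of_real q) q *
                 of_real (q powr (real (m div 2) * (real n * t - real (m div 2)))))) \<and>
          (\<exists>N. \<forall>n m :: nat. N \<le> n \<and> 0 < n \<and> 0 < m \<and> t * real n = real m + l \<longrightarrow>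
             norm (r n) \<le>
               3 * qpoch_inf (- (q ^ 3)) q * theta (inverse (norm u)) q / (1 - q) *
                 (q powr (real m / 4) +
                  q powr ((real m)\<^sup>2 / 16) / norm u ^ (m div 4 + 1)))))
     \<and>
     (\<forall>t \<beta> :: real. 0 < t \<and> t \<notin> \<rat> \<and> 0 \<le> \<beta> \<and> \<beta> < 1 \<longrightarrow>
        infinite {(n :: nat, m :: nat). 0 < n \<and> 0 < m \<and>
          (\<exists>\<gamma> :: real. real n * t = real m + \<beta> + \<gamma> \<and> \<bar>\<gamma>\<bar> \<le> 3 / real n)} \<and>
        (\<exists>e :: nat \<Rightarrow> nat \<Rightarrow> complex.
          (\<forall>n m :: nat. 0 < n \<and> 0 < m \<and>
             (\<exists>\<gamma> :: real. real n * t = real m + \<beta> + \<gamma> \<and> \<bar>\<gamma>\<bar> \<le> 3 / real n) \<longrightarrow>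
             ramanujan_A q (of_real (q powr (- (real n * t))) * u) =
               (- u) ^ (m div 2) *
                 (theta (- inverse u * of_real (q powr (of_int (chi (int m)) + \<beta>))) (q\<^sup>2) + e n m) /
               (qpoch_inf (of_real q) q *
                 of_real (q powr (real (m div 2) * (real n * t - real (m div 2)))))) \<and>
          (\<exists>N. \<forall>n m :: nat. N \<le> n \<and> 0 < n \<and> 0 < m \<and>
             (\<exists>\<gamma> :: real. real n * t = real m + \<beta> + \<gamma> \<and> \<bar>\<gamma>\<bar> \<le> 3 / real n) \<longrightarrow>
             norm (e n m) \<le>
               48 * qpoch_inf (- (q ^ 3)) q * theta (inverse (norm u)) q / (1 - q) *
                 (ln (real n) / real n +
                  q powr ((of_int (nu q n))\<^sup>2 / 2) * norm u powi nu q n +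
                  q powr ((of_int (nu q n))\<^sup>2 / 2) / norm u powi (1 + nu q n)))))"
proof -
  let ?K = "qpoch_inf (- (q ^ 3)) q * theta (inverse (norm u)) q / (1 - q)"
  have "0 < qpoch_inf (- (q ^ 3)) q"
    using q by (intro qpoch_inf_pos) (auto intro: less_trans[of _ 0])
  moreover have "0 < theta (inverse (norm u)) q"
    using q u by (intro theta_pos) auto
  ultimately have K: "0 < ?K"
    using q by simp
  then have K3: "0 < 3 * qpoch_inf (- (q ^ 3)) q * theta (inverse (norm u)) q / (1 - q)" (is "0 < ?K3")
    and K48: "0 < 48 * qpoch_inf (- (q ^ 3)) q * theta (inverse (norm u)) q / (1 - q)" (is "0 < ?K48")
    by simp_all
  show ?thesis
  proof (intro conjI allI impI; elim conjE)
    fix t l :: real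
    assume t: "0 < t" "t \<in> \<rat>" and l: "l \<in> frac_multiples t"
    show "infinite {(n :: nat, m :: nat). 0 < n \<and> 0 < m \<and> t * real n = real m + l}"
      by (rule rational_pairs_infinite[OF t l])
    from l have l01: "0 \<le> l" "l < 1"
      by (auto simp: frac_multiples_def frac_lt_1)
    show "\<exists>r :: nat \<Rightarrow> complex.
          (\<forall>n m :: nat. 0 < n \<and> 0 < m \<and> t * real n = real m + l \<longrightarrow>
             ramanujan_A q (of_real (q powr (- (real n * t))) * u) =
               (- u) ^ (m div 2) *
                 (theta (- inverse u * of_real (q powr (of_int (chi (int m)) + l))) (q\<^sup>2) + r n) /
               (qpoch_inf (of_real q) q *
                 of_real (q powr (real (m div 2) * (real n * t - real (m div 2)))))) \<and>
          (\<exists>N. \<forall>n m :: nat. N \<le> n \<and> 0 < n \<and> 0 < m \<and> t * real n = real m + l \<longrightarrow>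
             norm (r n) \<le> ?K3 *
                 (q powr (real m / 4) +
                  q powr ((real m)\<^sup>2 / 16) / norm u ^ (m div 4 + 1)))"
      (is "\<exists>r. ?id r \<and> (\<exists>N. \<forall>n m. ?P N n m \<longrightarrow> norm (r n) \<le> ?K3 * ?E m)")
    proof -
      have "\<exists>r. ?id r \<and> (\<exists>N. \<forall>n m. ?P N n m \<longrightarrow> norm (r n) \<le> ?K3 * q powr (real m / 4))"
        by (rule rational_case[OF q u t(1) l01 K3])
      then obtain r N where r: "?id r"
        and N: "\<And>n m. ?P N n m \<Longrightarrow> norm (r n) \<le> ?K3 * q powr (real m / 4)"
        by metis
      have "?K3 * q powr (real m / 4) \<le> ?K3 * ?E m" for m
        by (rule mult_left_mono[OF _ less_imp_le[OF K3]]) simp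
      with r N show ?thesis
        by (intro exI[of _ r] conjI exI[of _ N] allI impI) (blast intro: order_trans)+
    qed
  next
    fix t \<beta> :: real
    assume t: "0 < t" "t \<notin> \<rat>" and \<beta>: "0 \<le> \<beta>" "\<beta> < 1"
    show "infinite {(n :: nat, m :: nat). 0 < n \<and> 0 < m \<and>
          (\<exists>\<gamma> :: real. real n * t = real m + \<beta> + \<gamma> \<and> \<bar>\<gamma>\<bar> \<le> 3 / real n)}"
      by (rule irrational_pairs_infinite[OF t])
    show "\<exists>e :: nat \<Rightarrow> nat \<Rightarrow> complex.
          (\<forall>n m :: nat. 0 < n \<and> 0 < m \<and>
             (\<exists>\<gamma> :: real. real n * t = real m + \<beta> + \<gamma> \<and> \<bar>\<gamma>\<bar> \<le> 3 / real n) \<longrightarrow>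
             ramanujan_A q (of_real (q powr (- (real n * t))) * u) =
               (- u) ^ (m div 2) *
                 (theta (- inverse u * of_real (q powr (of_int (chi (int m)) + \<beta>))) (q\<^sup>2) + e n m) /
               (qpoch_inf (of_real q) q *
                 of_real (q powr (real (m div 2) * (real n * t - real (m div 2)))))) \<and>
          (\<exists>N. \<forall>n m :: nat. N \<le> n \<and> 0 < n \<and> 0 < m \<and>
             (\<exists>\<gamma> :: real. real n * t = real m + \<beta> + \<gamma> \<and> \<bar>\<gamma>\<bar> \<le> 3 / real n) \<longrightarrow>
             norm (e n m) \<le> ?K48 *
                 (ln (real n) / real n +
                  q powr ((of_int (nu q n))\<^sup>2 / 2) * norm u powi nu q n +
                  q powr ((of_int (nu q n))\<^sup>2 / 2) / norm u powi (1 + nu q n)))"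
      (is "\<exists>e. ?id e \<and> (\<exists>N. \<forall>n m. ?P N n m \<longrightarrow> norm (e n m) \<le> ?K48 * ?E n)")
    proof -
      have "\<exists>e. ?id e \<and> (\<exists>N. \<forall>n m. ?P N n m \<longrightarrow> norm (e n m) \<le> ?K48 * (ln (real n) / real n))"
        by (rule irrational_case[OF q u t(1) \<beta> K48])
      then obtain e N where e: "?id e"
        and N: "\<And>n m. ?P N n m \<Longrightarrow> norm (e n m) \<le> ?K48 * (ln (real n) / real n)"
        by metis
      \<comment> \<open>The two summands with \<open>nu\<close> are nonnegative, as integer powers
        of |u| are.\<close>
      have "?K48 * (ln (real n) / real n) \<le> ?K48 * ?E n" for n
        by (rule mult_left_mono[OF _ less_imp_le[OF K48]]) (simp add: zero_le_power_int)
      with e N show ?thesis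
        by (intro exI[of _ e] conjI exI[of _ N] allI impI) (blast intro: order_trans)+
    qed
  qed
qed

end
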